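(* Let $(\alpha,m)\in(0,1]^2$, let $g:[0,\infty)\to\mathbb{R}$ be an $(\alpha,m)$-convex function, let $f:[0,\infty)\to\mathbb{R}$ be a $(g-(\alpha,m))$-convex dominated function, and let $0\le a<b$. (i) If $f\in L_1[a,b]\cap L_1\left[\frac{a}{m},\frac{b}{m}\right]$, then $$\left|\frac{1}{b-a}\int_a^b\frac{f(x)+m(2^\alpha-1)f\left(\frac{x}{m}\right)}{2^\alpha}\,dx-f\left(\frac{a+b}{2}\right)\right|\le\frac{1}{b-a}\int_a^b\frac{g(x)+m(2^\alpha-1)g\left(\frac{x}{m}\right)}{2^\alpha}\,dx-g\left(\frac{a+b}{2}\right).$$ (ii) If $f\in L_1[a,b]$, then $$\left|\frac12\left[\frac{f(a)+mf\left(\frac{a}{m}\right)}{\alpha+1}+m\alpha\,\frac{f\left(\frac{b}{m}\right)+mf\left(\frac{b}{m^2}\right)}{\alpha+1}\right]-\frac{1}{b-a}\int_a^b\frac{f(x)+mf\left(\frac{x}{m}\right)}{2}\,dx\right|$$ $$\le\frac12\left[\frac{g(a)+mg\left(\frac{a}{m}\right)}{\alpha+1}+m\alpha\,\frac{g\left(\frac{b}{m}\right)+mg\left(\frac{b}{m^2}\right)}{\alpha+1}\right]-\frac{1}{b-a}\int_a^b\frac{g(x)+mg\left(\frac{x}{m}\right)}{2}\,dx.$$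
   Context: Let $J$ be $[0,c]$ with $c>0$, or $[0,\infty)$, and let $(\alpha,m)\in[0,1]^2$ be fixed. A function $g:J\to\mathbb{R}$ is $(\alpha,m)$-convex if $g(tx+m(1-t)y)\le t^\alpha g(x)+m(1-t^\alpha)g(y)$ for all $x,y\in J$ and $t\in[0,1]$. Given an $(\alpha,m)$-convex function $g:J\to\mathbb{R}$, a function $f:J\to\mathbb{R}$ is called $(g-(\alpha,m))$-convex dominated on $J$ if $$\left|\lambda^\alpha f(x)+m(1-\lambda^\alpha)f(y)-f(\lambda x+m(1-\lambda)y)\right|\le\lambda^\alpha g(x)+m(1-\lambda^\alpha)g(y)-g(\lambda x+m(1-\lambda)y)$$ for all $x,y\in J$ and $\lambda\in[0,1]$. $L_1[a,b]$ denotes the Lebesgue integrable functions on $[a,b]$. *)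

theory Defs
  imports "HOL-Analysis.Analysis"
begin

text \<open>
  For 0 \<le> t, the power t to the exponent \<alpha> with the convention that the exponent 0 yields 1,
  also at t = 0, where 0 powr 0 = 0. With it, the parameters (0, 0) below characterise the
  nondecreasing functions on J.
\<close>

definition rpow :: "real \<Rightarrow> real \<Rightarrow> real" where
  "rpow t \<alpha> = (if \<alpha> = 0 then 1 else t powr \<alpha>)"

text \<open>
  The set J is meant to be {0..c} with 0 < c, or {0..}, and both parameters lie in {0..1}.
  Functions on J are total functions on the reals of which only the values on J matter.
\<close>

definition am_convex_on :: "real set \<Rightarrow> real \<Rightarrow> real \<Rightarrow> (real \<Rightarrow> real) \<Rightarrow> bool" where
  "am_convex_on J \<alpha> m g \<longleftrightarrow>
    (\<forall>x\<in>J. \<forall>y\<in>J. \<forall>t\<in>{0..1}.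
      g (t * x + m * (1 - t) * y) \<le> rpow t \<alpha> * g x + m * (1 - rpow t \<alpha>) * g y)"

definition am_convex_dominated_on ::
    "real set \<Rightarrow> real \<Rightarrow> real \<Rightarrow> (real \<Rightarrow> real) \<Rightarrow> (real \<Rightarrow> real) \<Rightarrow> bool" where
  "am_convex_dominated_on J \<alpha> m g f \<longleftrightarrow>
    (\<forall>x\<in>J. \<forall>y\<in>J. \<forall>t\<in>{0..1}.
      \<bar>rpow t \<alpha> * f x + m * (1 - rpow t \<alpha>) * f y - f (t * x + m * (1 - t) * y)\<bar>
        \<le> rpow t \<alpha> * g x + m * (1 - rpow t \<alpha>) * g y - g (t * x + m * (1 - t) * y))"

end

theory Submission
  imports Defs
begin

text \<open>
  A function f is dominated by g exactly when both g + f and g - f are (\<alpha>, m)-convex, and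
  |F| \<le> G is the pair of inequalities 0 \<le> G + F and 0 \<le> G - F. Since both sides of
  each claimed inequality are the same linear expression in f and in g, everything reduces to
  one-sided Hermite--Hadamard inequalities for a single (\<alpha>, m)-convex function p, applied to
  p = g + f and p = g - f.

  The one-sided inequalities come from integrating a pointwise instance of convexity over [a, b]:
  for the midpoint, (a + b) / 2 is the combination of x and (a + b - x) / m with weight t = 1 / 2,
  and the reflection a + b - x may be replaced by x under the integral; for the endpoints, x in
  [a, b] is the combination of a and b / m with weight t = (b - x) / (b - a), and t powr \<alpha> has
  mean 1 / (\<alpha> + 1). The second pair of endpoint terms is the same estimate for the dilated function
  p (x / m), which is again (\<alpha>, m)-convex.

  For this the integrals must exist, also that of f (x / m) in the second part, where integrability
  of f is known only on [a, b], and those of g. They do because (\<alpha>, m)-convexity with positive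
  parameters forces integrability on every bounded interval in [0, \<infinity>): taking y = 0 shows that
  (p x - m p 0) / x powr \<alpha> is nondecreasing, so p is measurable, and p is locally bounded.
\<close>

section \<open>Convexity of the sum and the difference, and dilations\<close>

lemma am_convex_onD:
  assumes "am_convex_on {0..} \<alpha> m p" "0 < \<alpha>" "0 \<le> x" "0 \<le> y" "0 \<le> t" "t \<le> 1"
  shows "p (t * x + m * (1 - t) * y) \<le> t powr \<alpha> * p x + m * (1 - t powr \<alpha>) * p y"
  using assms by (auto simp: am_convex_on_def rpow_def)

lemma am_convex_dominated_imp_am_convex:
  assumes "am_convex_dominated_on J \<alpha> m g f"
  shows "am_convex_on J \<alpha> m (\<lambda>x. g x + f x)" "am_convex_on J \<alpha> m (\<lambda>x. g x - f x)"
  using assms unfolding am_convex_on_def am_convex_dominated_on_def abs_le_iff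
  by (fastforce simp: algebra_simps)+

lemma am_convex_on_dilation:
  assumes "am_convex_on {0..} \<alpha> m p" "0 < c"
  shows "am_convex_on {0..} \<alpha> m (\<lambda>x. p (x / c))"
  unfolding am_convex_on_def
proof (intro ballI)
  fix x y t :: real
  assume *: "x \<in> {0..}" "y \<in> {0..}" "t \<in> {0..1}"
  have "(t * x + m * (1 - t) * y) / c = t * (x / c) + m * (1 - t) * (y / c)"
    by (simp add: add_divide_distrib)
  moreover have "x / c \<in> {0..}" "y / c \<in> {0..}"
    using * assms(2) by auto
  ultimately show "p ((t * x + m * (1 - t) * y) / c)
      \<le> rpow t \<alpha> * p (x / c) + m * (1 - rpow t \<alpha>) * p (y / c)"
    using assms(1) *(3) unfolding am_convex_on_def by metis
qed

section \<open>Integrability\<close>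

text \<open>
  Convexity towards the point 0 reads p (t x) - m p 0 \<le> t powr \<alpha> (p x - m p 0), which for t = u / v
  compares the quotients at u \<le> v. Subtracting m p 0 instead of p 0 is what makes this work for
  every m.
\<close>

lemma am_convex_on_imp_mono_quotient:
  assumes "am_convex_on {0..} \<alpha> m p" "0 < \<alpha>"
  shows "mono_on {0<..} (\<lambda>x. (p x - m * p 0) / x powr \<alpha>)"
proof (rule mono_onI)
  fix u v :: real
  assume *: "u \<in> {0<..}" "v \<in> {0<..}" "u \<le> v"
  have "p (u / v * v + m * (1 - u / v) * 0)
      \<le> (u / v) powr \<alpha> * p v + m * (1 - (u / v) powr \<alpha>) * p 0"
    using * by (intro am_convex_onD assms) auto
  then have "p u - m * p 0 \<le> (u / v) powr \<alpha> * (p v - m * p 0)"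
    using * by (simp add: algebra_simps)
  also have "\<dots> = u powr \<alpha> * ((p v - m * p 0) / v powr \<alpha>)"
    using * by (simp add: powr_divide)
  finally show "(p u - m * p 0) / u powr \<alpha> \<le> (p v - m * p 0) / v powr \<alpha>"
    using * by (simp add: field_simps)
qed

lemma am_convex_on_imp_bounded_above:
  assumes "am_convex_on {0..} \<alpha> m p" "0 < \<alpha>" "0 < m" "0 \<le> x" "x \<le> B" "0 < B"
  shows "p x \<le> \<bar>p B\<bar> + m * \<bar>p 0\<bar>"
proof -
  define s where "s = (x / B) powr \<alpha>"
  have s: "0 \<le> s" "s \<le> 1"
    using assms by (auto simp: s_def intro!: powr_le1)
  have "p (x / B * B + m * (1 - x / B) * 0) \<le> s * p B + m * (1 - s) * p 0"
    unfolding s_def using assms by (intro am_convex_onD) auto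
  then have "p x \<le> s * p B + m * ((1 - s) * p 0)"
    using assms by (simp add: mult.assoc)
  also have "\<dots> \<le> \<bar>s * p B\<bar> + m * \<bar>(1 - s) * p 0\<bar>"
    using assms by (intro add_mono mult_left_mono) auto
  also have "\<dots> = s * \<bar>p B\<bar> + m * ((1 - s) * \<bar>p 0\<bar>)"
    using s by (simp add: abs_mult)
  also have "\<dots> \<le> \<bar>p B\<bar> + m * \<bar>p 0\<bar>"
    using assms s by (intro add_mono mult_left_mono mult_left_le_one_le) auto
  finally show ?thesis .
qed

text \<open>
  For x in [0, B], the fixed point B is the combination of x and (2 B - x) / m with weight 1 / 2.
  As p is bounded above at the latter point by a constant, p x cannot be too small.
\<close>

lemma am_convex_on_imp_bounded:
  assumes "am_convex_on {0..} \<alpha> m p" "0 < \<alpha>" "0 < m" "0 < B"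
  obtains C where "\<And>x. 0 \<le> x \<Longrightarrow> x \<le> B \<Longrightarrow> \<bar>p x\<bar> \<le> C"
proof -
  define s :: real where "s = (1 / 2) powr \<alpha>"
  have s: "0 < s" "s \<le> 1"
    using assms by (auto simp: s_def intro!: powr_le1)
  define U where "U = \<bar>p (2 * B / m)\<bar> + m * \<bar>p 0\<bar>"
  define L where "L = (p B - m * (1 - s) * U) / s"
  have "\<bar>p x\<bar> \<le> \<bar>L\<bar> + (\<bar>p B\<bar> + m * \<bar>p 0\<bar>)" if x: "0 \<le> x" "x \<le> B" for x
  proof -
    have "p (1 / 2 * x + m * (1 - 1 / 2) * ((2 * B - x) / m))
        \<le> s * p x + m * (1 - s) * p ((2 * B - x) / m)"
      unfolding s_def using assms x by (intro am_convex_onD) auto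
    also have "1 / 2 * x + m * (1 - 1 / 2) * ((2 * B - x) / m) = B"
      using assms by (simp add: field_simps)
    also have "s * p x + m * (1 - s) * p ((2 * B - x) / m) \<le> s * p x + m * (1 - s) * U"
      unfolding U_def using assms x s
      by (intro add_left_mono mult_left_mono am_convex_on_imp_bounded_above)
         (auto simp: divide_right_mono)
    finally have "p B - m * (1 - s) * U \<le> p x * s"
      by (simp add: mult.commute)
    then have "L \<le> p x"
      using s by (simp add: L_def pos_divide_le_eq)
    moreover have "p x \<le> \<bar>p B\<bar> + m * \<bar>p 0\<bar>"
      using am_convex_on_imp_bounded_above[OF assms(1-3) x assms(4)] .
    ultimately show ?thesis
      using assms(3) by (smt (verit) mult_nonneg_nonneg)
  qed
  then show ?thesis
    by (rule that)
qed

text \<open>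
  A monotone function is Borel measurable, hence so is p on the positive reals, being recovered from
  the monotone quotient; together with boundedness this gives integrability.
\<close>

lemma am_convex_on_imp_absolutely_integrable:
  assumes "am_convex_on {0..} \<alpha> m p" "0 < \<alpha>" "0 < m" "0 \<le> a"
  shows "set_integrable lebesgue {a..b} p"
proof (cases "a < b")
  case True
  \<comment> \<open>The quotient is monotone only for positive x, hence the half-open interval.\<close>
  define h where "h = (\<lambda>x. (p x - m * p 0) / x powr \<alpha>)"
  have h: "h \<in> borel_measurable (restrict_space borel {0<..})"
    unfolding h_def
    by (intro borel_measurable_mono_on_fnc am_convex_on_imp_mono_quotient[OF assms(1,2)])
  have "(\<lambda>x. h x * x powr \<alpha> + m * p 0) \<in> borel_measurable (restrict_space borel {0<..})"
    by (intro borel_measurable_add borel_measurable_times h) (auto intro!: measurable_restrict_space1)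
  then have "p \<in> borel_measurable (restrict_space borel {0<..})"
    by (rule measurable_cong[THEN iffD1, rotated]) (auto simp: h_def space_restrict_space)
  then have "set_borel_measurable borel {0<..} p"
    by (simp add: borel_measurable_restrict_space_iff set_borel_measurable_def)
  then have "set_borel_measurable borel {a<..b} p"
    by (rule set_borel_measurable_subset) (use assms in auto)
  then have "p \<in> borel_measurable (lebesgue_on {a<..b})"
    unfolding set_borel_measurable_def
    by (subst borel_measurable_restrict_space_iff) (auto simp: measurable_completion)
  moreover obtain C where C: "\<And>x. 0 \<le> x \<Longrightarrow> x \<le> b \<Longrightarrow> \<bar>p x\<bar> \<le> C"
    using am_convex_on_imp_bounded[OF assms(1-3)] True assms(4) by (metis le_less_trans)
  ultimately have "p absolutely_integrable_on {a<..b}"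
    using assms(4)
    by (intro measurable_bounded_by_integrable_imp_absolutely_integrable[where g = "\<lambda>_. C"])
       (auto intro!: integrable_on_const bounded_set_imp_lmeasurable)
  moreover have "p absolutely_integrable_on {a}"
    using integrable_negligible[OF negligible_sing] by (auto simp: absolutely_integrable_on_def)
  ultimately have "p absolutely_integrable_on ({a} \<union> {a<..b})"
    by (intro set_integrable_Un) auto
  also have "{a} \<union> {a<..b} = {a..b}"
    using True by auto
  finally show ?thesis .
next
  case False
  then have "negligible {a..b}"
    by (cases "a = b") auto
  then show ?thesis
    by (auto simp: absolutely_integrable_on_def intro: integrable_negligible)
qed

section \<open>One-sided Hermite--Hadamard inequalities\<close>

lemma set_integral_reflect:
  fixes p :: "real \<Rightarrow> real"
  assumes "set_integrable lebesgue {a..b} p"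
  shows "set_integrable lebesgue {a..b} (\<lambda>x. p (a + b - x))"
    and "(LINT x:{a..b}|lebesgue. p (a + b - x)) = (LINT x:{a..b}|lebesgue. p x)"
proof -
  have "(\<lambda>x. \<bar>-1\<bar> * p (a + b - x)) absolutely_integrable_on {a..b} \<and>
        integral {a..b} (\<lambda>x. \<bar>-1\<bar> * p (a + b - x)) = integral {a..b} p
    \<longleftrightarrow> p absolutely_integrable_on (\<lambda>x. a + b - x) ` {a..b} \<and>
        integral ((\<lambda>x. a + b - x) ` {a..b}) p = integral {a..b} p"
    by (intro has_absolute_integral_change_of_variables_1')
       (auto intro!: derivative_eq_intros inj_onI)
  then have *: "(\<lambda>x. p (a + b - x)) absolutely_integrable_on {a..b}"
      "integral {a..b} (\<lambda>x. p (a + b - x)) = integral {a..b} p"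
    using assms by auto
  show "set_integrable lebesgue {a..b} (\<lambda>x. p (a + b - x))"
    by (rule *(1))
  show "(LINT x:{a..b}|lebesgue. p (a + b - x)) = (LINT x:{a..b}|lebesgue. p x)"
    using * assms by (simp add: set_lebesgue_integral_eq_integral(2))
qed

text \<open>
  Convexity bounds p ((a + b) / 2) by a weighted sum of p x and p ((a + b - x) / m), for every
  x in [a, b]. The reflection of x in the midpoint preserves integrals over [a, b], so after
  integration p ((a + b - x) / m) may be replaced by p (x / m).
\<close>

lemma am_convex_on_midpoint_le_average:
  assumes "am_convex_on {0..} \<alpha> m p" "0 < \<alpha>" "0 < m" "0 \<le> a" "a < b"
  shows "p ((a + b) / 2) \<le> 1 / (b - a) * (LINT x:{a..b}|lebesgue.
            (p x + m * (2 powr \<alpha> - 1) * p (x / m)) / 2 powr \<alpha>)"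
proof -
  define q where "q = (\<lambda>x. p (x / m))"
  have p: "set_integrable lebesgue {a..b} p"
    using assms by (intro am_convex_on_imp_absolutely_integrable)
  have q: "set_integrable lebesgue {a..b} q"
    unfolding q_def using assms
    by (intro am_convex_on_imp_absolutely_integrable am_convex_on_dilation)
  note q' = set_integral_reflect[OF q]
  have "p ((a + b) / 2) \<le> 1 / 2 powr \<alpha> * p x + m * (2 powr \<alpha> - 1) / 2 powr \<alpha> * q (a + b - x)"
    if "x \<in> {a..b}" for x
  proof -
    have "p (1 / 2 * x + m * (1 - 1 / 2) * ((a + b - x) / m))
        \<le> (1 / 2) powr \<alpha> * p x + m * (1 - (1 / 2) powr \<alpha>) * p ((a + b - x) / m)"
      using assms that by (intro am_convex_onD) auto
    also have "1 / 2 * x + m * (1 - 1 / 2) * ((a + b - x) / m) = (a + b) / 2"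
      using assms by (simp add: field_simps)
    also have "(1 / 2) powr \<alpha> = 1 / 2 powr \<alpha>"
      by (simp add: powr_divide)
    finally show ?thesis
      by (simp add: q_def diff_divide_distrib right_diff_distrib)
  qed
  then have "(LINT x:{a..b}|lebesgue. p ((a + b) / 2)) \<le> (LINT x:{a..b}|lebesgue.
      1 / 2 powr \<alpha> * p x + m * (2 powr \<alpha> - 1) / 2 powr \<alpha> * q (a + b - x))"
    by (intro set_integral_mono set_integral_add(1) set_integrable_mult_right p q')
       (auto simp: absolutely_integrable_on_def)
  also have "\<dots> = (LINT x:{a..b}|lebesgue.
      1 / 2 powr \<alpha> * p x + m * (2 powr \<alpha> - 1) / 2 powr \<alpha> * q x)"
    using p q q' by (simp add: set_integral_add)
  also have "\<dots> = (LINT x:{a..b}|lebesgue.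
            (p x + m * (2 powr \<alpha> - 1) * p (x / m)) / 2 powr \<alpha>)"
    by (simp add: q_def add_divide_distrib)
  also have "(LINT x:{a..b}|lebesgue. p ((a + b) / 2)) = (b - a) * p ((a + b) / 2)"
    using assms by (simp add: set_lebesgue_integral_def)
  finally show ?thesis
    using assms by (simp add: field_simps)
qed

lemma has_integral_weight_powr:
  fixes \<alpha> a b :: real
  assumes "0 < \<alpha>" "a < b"
  shows "((\<lambda>x. ((b - x) / (b - a)) powr \<alpha>) has_integral (b - a) / (\<alpha> + 1)) {a..b}"
proof -
  define F where "F = (\<lambda>x. - (b - a) / (\<alpha> + 1) * ((b - x) / (b - a)) powr (\<alpha> + 1))"
  have "((\<lambda>x. ((b - x) / (b - a)) powr \<alpha>) has_integral F b - F a) {a..b}"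
  proof (rule fundamental_theorem_of_calculus_interior)
    show "continuous_on {a..b} F"
      unfolding F_def using assms by (intro continuous_intros continuous_on_powr') auto
    show "(F has_vector_derivative ((b - x) / (b - a)) powr \<alpha>) (at x)" if "x \<in> {a<..<b}" for x
      unfolding F_def has_real_derivative_iff_has_vector_derivative[symmetric]
      using assms that
      by (auto intro!: derivative_eq_intros simp: divide_simps) (simp add: algebra_simps)
  qed (use assms in auto)
  also have "F b - F a = (b - a) / (\<alpha> + 1)"
    using assms by (simp add: F_def minus_divide_left)
  finally show ?thesis .
qed

text \<open>
  Writing x as the combination of a and b / m with weight t = (b - x) / (b - a), convexity bounds
  p on [a, b] by an affine function of t powr \<alpha>, whose integral is explicit.
\<close>

lemma am_convex_on_average_le_endpoints:
  assumes "am_convex_on {0..} \<alpha> m p" "0 < \<alpha>" "0 < m" "0 \<le> a" "a < b"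
  shows "1 / (b - a) * (LINT x:{a..b}|lebesgue. p x)
    \<le> p a / (\<alpha> + 1) + m * \<alpha> * (p (b / m) / (\<alpha> + 1))"
proof -
  define w where "w = (\<lambda>x. ((b - x) / (b - a)) powr \<alpha>)"
  have p: "set_integrable lebesgue {a..b} p"
    using assms by (intro am_convex_on_imp_absolutely_integrable)
  have w: "(w has_integral (b - a) / (\<alpha> + 1)) {a..b}"
    unfolding w_def using assms by (intro has_integral_weight_powr)
  have "((\<lambda>x. m * p (b / m)) has_integral (b - a) * (m * p (b / m))) {a..b}"
    using has_integral_const_real[of "m * p (b / m)" a b] assms by simp
  from has_integral_add[OF has_integral_mult_right[OF w] this]
  have upper: "((\<lambda>x. (p a - m * p (b / m)) * w x + m * p (b / m)) has_integral
      (p a - m * p (b / m)) * ((b - a) / (\<alpha> + 1)) + (b - a) * (m * p (b / m))) {a..b}" .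
  have "p x \<le> (p a - m * p (b / m)) * w x + m * p (b / m)" if "x \<in> {a..b}" for x
  proof -
    define t where "t = (b - x) / (b - a)"
    have t: "0 \<le> t" "t \<le> 1"
      using assms that by (auto simp: t_def)
    have "p (t * a + m * (1 - t) * (b / m)) \<le> t powr \<alpha> * p a + m * (1 - t powr \<alpha>) * p (b / m)"
      using assms t by (intro am_convex_onD) auto
    also have "t * a + m * (1 - t) * (b / m) = b - t * (b - a)"
      using assms by (simp add: algebra_simps)
    also have "\<dots> = x"
      using assms by (simp add: t_def)
    finally show ?thesis
      by (simp add: w_def t_def algebra_simps)
  qed
  then have "(LINT x:{a..b}|lebesgue. p x)
      \<le> (p a - m * p (b / m)) * ((b - a) / (\<alpha> + 1)) + (b - a) * (m * p (b / m))"
    using has_integral_le[OF _ upper] has_integral_set_lebesgue[OF p] by blast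
  also have "\<dots> = (b - a) * (p a / (\<alpha> + 1) + m * p (b / m) * (1 - 1 / (\<alpha> + 1)))"
    by (simp add: algebra_simps)
  also have "1 - 1 / (\<alpha> + 1) = \<alpha> / (\<alpha> + 1)"
    using assms by (simp add: field_simps)
  finally show ?thesis
    using assms by (simp add: pos_divide_le_eq mult_ac)
qed

text \<open>
  This is the endpoint estimate for p plus m times that for p (x / m); the endpoint b / m of the
  dilated function gives the value of p at b / m^2.
\<close>

lemma am_convex_on_average_le_dilated_endpoints:
  assumes "am_convex_on {0..} \<alpha> m p" "0 < \<alpha>" "0 < m" "0 \<le> a" "a < b"
  shows "1 / (b - a) * (LINT x:{a..b}|lebesgue. (p x + m * p (x / m)) / 2)
    \<le> 1 / 2 * ((p a + m * p (a / m)) / (\<alpha> + 1)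
              + m * \<alpha> * ((p (b / m) + m * p (b / m^2)) / (\<alpha> + 1)))"
proof -
  define q where "q = (\<lambda>x. p (x / m))"
  have cq: "am_convex_on {0..} \<alpha> m q"
    unfolding q_def using assms by (intro am_convex_on_dilation)
  have p: "set_integrable lebesgue {a..b} p" and q: "set_integrable lebesgue {a..b} q"
    using assms cq by (auto intro: am_convex_on_imp_absolutely_integrable)
  define P Q where "P = 1 / (b - a) * (LINT x:{a..b}|lebesgue. p x)"
    and "Q = 1 / (b - a) * (LINT x:{a..b}|lebesgue. q x)"
  have "1 / (b - a) * (LINT x:{a..b}|lebesgue. (p x + m * q x) / 2) = 1 / 2 * (P + m * Q)"
    using p q by (simp add: P_def Q_def set_integral_add add_divide_distrib mult.commute)
  also have "\<dots> \<le> 1 / 2 * ((p a / (\<alpha> + 1) + m * \<alpha> * (p (b / m) / (\<alpha> + 1)))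
      + m * (q a / (\<alpha> + 1) + m * \<alpha> * (q (b / m) / (\<alpha> + 1))))"
    unfolding P_def Q_def using assms cq
    by (intro mult_left_mono add_mono am_convex_on_average_le_endpoints) auto
  also have "\<dots> = 1 / 2 * ((p a + m * q a) / (\<alpha> + 1)
              + m * \<alpha> * ((p (b / m) + m * q (b / m)) / (\<alpha> + 1)))"
    by (simp add: add_divide_distrib algebra_simps)
  finally show ?thesis
    by (simp add: q_def power2_eq_square)
qed

section \<open>The Hermite--Hadamard inequalities for dominated functions\<close>

theorem theorem5:
  fixes \<alpha> m a b :: real and f g :: "real \<Rightarrow> real"
  assumes "0 < \<alpha>" and "\<alpha> \<le> 1" and "0 < m" and "m \<le> 1"
    and "am_convex_on {0..} \<alpha> m g"
    and "am_convex_dominated_on {0..} \<alpha> m g f"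
    and "0 \<le> a" and "a < b"
  shows
    "(set_integrable lebesgue {a..b} f \<and> set_integrable lebesgue {a/m..b/m} f \<longrightarrow>
       \<bar>1 / (b - a) * (LINT x:{a..b}|lebesgue.
            (f x + m * (2 powr \<alpha> - 1) * f (x / m)) / 2 powr \<alpha>) - f ((a + b) / 2)\<bar>
       \<le> 1 / (b - a) * (LINT x:{a..b}|lebesgue.
            (g x + m * (2 powr \<alpha> - 1) * g (x / m)) / 2 powr \<alpha>) - g ((a + b) / 2))
     \<and>
     (set_integrable lebesgue {a..b} f \<longrightarrow>
       \<bar>1 / 2 * ((f a + m * f (a / m)) / (\<alpha> + 1)
              + m * \<alpha> * ((f (b / m) + m * f (b / m^2)) / (\<alpha> + 1)))
         - 1 / (b - a) * (LINT x:{a..b}|lebesgue. (f x + m * f (x / m)) / 2)\<bar>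
       \<le> 1 / 2 * ((g a + m * g (a / m)) / (\<alpha> + 1)
              + m * \<alpha> * ((g (b / m) + m * g (b / m^2)) / (\<alpha> + 1)))
         - 1 / (b - a) * (LINT x:{a..b}|lebesgue. (g x + m * g (x / m)) / 2))"
proof -
  let ?u = "\<lambda>x. g x + f x" and ?v = "\<lambda>x. g x - f x"
  have u: "am_convex_on {0..} \<alpha> m ?u" and v: "am_convex_on {0..} \<alpha> m ?v"
    using am_convex_dominated_imp_am_convex[OF assms(6)] by auto
  have g: "set_integrable lebesgue {a..b} g" "set_integrable lebesgue {a..b} (\<lambda>x. g (x / m))"
    using assms by (auto intro: am_convex_on_imp_absolutely_integrable am_convex_on_dilation)
  have "set_integrable lebesgue {a..b} ?u" "set_integrable lebesgue {a..b} (\<lambda>x. ?u (x / m))"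
    using assms u am_convex_on_dilation[OF u]
    by (auto intro: am_convex_on_imp_absolutely_integrable)
  from set_integral_diff(1)[OF this(1) g(1)] set_integral_diff(1)[OF this(2) g(2)]
  have f: "set_integrable lebesgue {a..b} f" "set_integrable lebesgue {a..b} (\<lambda>x. f (x / m))"
    by simp_all
  have split: "(LINT x:{a..b}|lebesgue. (?u x + c * ?u (x / m)) / d)
        = (LINT x:{a..b}|lebesgue. (g x + c * g (x / m)) / d)
        + (LINT x:{a..b}|lebesgue. (f x + c * f (x / m)) / d)"
      "(LINT x:{a..b}|lebesgue. (?v x + c * ?v (x / m)) / d)
        = (LINT x:{a..b}|lebesgue. (g x + c * g (x / m)) / d)
        - (LINT x:{a..b}|lebesgue. (f x + c * f (x / m)) / d)" for c d
  proof -
    have G: "set_integrable lebesgue {a..b} (\<lambda>x. (g x + c * g (x / m)) / d)"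
      and F: "set_integrable lebesgue {a..b} (\<lambda>x. (f x + c * f (x / m)) / d)"
      using f g by (auto intro!: set_integrable_divide set_integral_add)
    show "(LINT x:{a..b}|lebesgue. (?u x + c * ?u (x / m)) / d)
        = (LINT x:{a..b}|lebesgue. (g x + c * g (x / m)) / d)
        + (LINT x:{a..b}|lebesgue. (f x + c * f (x / m)) / d)"
      by (subst set_integral_add(2)[OF G F, symmetric])
         (simp add: add_divide_distrib algebra_simps)
    show "(LINT x:{a..b}|lebesgue. (?v x + c * ?v (x / m)) / d)
        = (LINT x:{a..b}|lebesgue. (g x + c * g (x / m)) / d)
        - (LINT x:{a..b}|lebesgue. (f x + c * f (x / m)) / d)"
      by (subst set_integral_diff(2)[OF G F, symmetric])
         (simp add: add_divide_distrib diff_divide_distrib algebra_simps)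
  qed
  note hyps = assms(1,3,7,8)
  note mid = am_convex_on_midpoint_le_average[OF u hyps, unfolded split]
    am_convex_on_midpoint_le_average[OF v hyps, unfolded split]
  have ends: "1 / 2 * ((?u a + m * ?u (a / m)) / (\<alpha> + 1)
        + m * \<alpha> * ((?u (b / m) + m * ?u (b / m^2)) / (\<alpha> + 1)))
      = 1 / 2 * ((g a + m * g (a / m)) / (\<alpha> + 1)
        + m * \<alpha> * ((g (b / m) + m * g (b / m^2)) / (\<alpha> + 1)))
      + 1 / 2 * ((f a + m * f (a / m)) / (\<alpha> + 1)
        + m * \<alpha> * ((f (b / m) + m * f (b / m^2)) / (\<alpha> + 1)))"
    "1 / 2 * ((?v a + m * ?v (a / m)) / (\<alpha> + 1)
        + m * \<alpha> * ((?v (b / m) + m * ?v (b / m^2)) / (\<alpha> + 1)))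
      = 1 / 2 * ((g a + m * g (a / m)) / (\<alpha> + 1)
        + m * \<alpha> * ((g (b / m) + m * g (b / m^2)) / (\<alpha> + 1)))
      - 1 / 2 * ((f a + m * f (a / m)) / (\<alpha> + 1)
        + m * \<alpha> * ((f (b / m) + m * f (b / m^2)) / (\<alpha> + 1)))"
    using assms(1) by (simp_all add: add_divide_distrib diff_divide_distrib algebra_simps)
  note avg = am_convex_on_average_le_dilated_endpoints[OF u hyps, unfolded split ends]
    am_convex_on_average_le_dilated_endpoints[OF v hyps, unfolded split ends]
  have "\<bar>k * F - f'\<bar> \<le> k * G - g'"
    if "g' + f' \<le> k * (G + F)" "g' - f' \<le> k * (G - F)" for f' g' k F G :: real
    using that by (auto simp: abs_le_iff algebra_simps)
  moreover have "\<bar>f' - k * F\<bar> \<le> g' - k * G"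
    if "k * (G + F) \<le> g' + f'" "k * (G - F) \<le> g' - f'" for f' g' k F G :: real
    using that by (auto simp: abs_le_iff algebra_simps)
  ultimately show ?thesis
    using mid avg by blast
qed

end
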